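(* Let $G$ be a group, let $\mu,\chi:G\to\mathbb{C}^*$ be different characters of $G$ and let $A:G\to\mathbb{C}$ be a nonzero additive function. The solutions $f,h_1,h_2,h:G\to\mathbb{C}$ of the functional equation $$f(xy)=f(x)h_1(y)+\mu(x)h_2(y)+\chi(x)A(x)h(y)\quad\text{for all }x,y\in G$$ are exactly the quadruples $(f,h_1,h_2,h)$ of one of the following forms: (1) $f=a\mu$, $h_1$ arbitrary, $h_2=a\mu-ah_1$ and $h=0$, where $a$ ranges over $\mathbb{C}$; (2) $f=a\mu_1+\varphi_{\mu_1,\mu}$, $h_1=\mu_1$, $h_2=\varphi_{\mu_1,\mu}$ and $h=0$, where $\mu_1$ is a character of $G$, $a$ ranges over $\mathbb{C}$, and $\varphi_{\mu_1,\mu}:G\to\mathbb{C}$ is a solution of $\varphi_{\mu_1,\mu}(xy)=\varphi_{\mu_1,\mu}(x)\mu_1(y)+\mu(x)\varphi_{\mu_1,\mu}(y)$ for all $x,y\in G$; (3) $f=a\mu+b\chi+b\alpha\chi A$, $h_1=\chi+\alpha\chi A$, $h_2=a\mu-a\chi-a\alpha\chi A$ and $h=-\alpha^2b\chi A$, where $a$ and $\alpha$ range over $\mathbb{C}$, and $b$ over $\mathbb{C}\setminus\{0\}$.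
   Context: A character of a group $G$ is a homomorphism from $G$ into the multiplicative group $\mathbb{C}^*$ of nonzero complex numbers. A function $A:G\to\mathbb{C}$ is additive if $A(xy)=A(x)+A(y)$ for all $x,y\in G$. $\chi A$ denotes the pointwise product. "Arbitrary" means an arbitrary function $G\to\mathbb{C}$. Within a given form, $\varphi_{\mu_1,\mu}$ denotes one and the same function at each occurrence. *)

theory Defs
  imports Complex_Main "HOL-Algebra.Group"
begin

definition complex_mult_group :: "complex monoid"
  where "complex_mult_group = \<lparr>carrier = UNIV - {0}, mult = (*), one = 1\<rparr>"

lemma group_complex_mult_group: "group complex_mult_group"
proof (rule groupI)
  show "\<exists>y \<in> carrier complex_mult_group. y \<otimes>\<^bsub>complex_mult_group\<^esub> x = \<one>\<^bsub>complex_mult_group\<^esub>"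
    if "x \<in> carrier complex_mult_group" for x
    using that by (intro bexI[of _ "inverse x"]) (auto simp: complex_mult_group_def)
qed (auto simp: complex_mult_group_def mult.assoc)

(* As everywhere in HOL-Algebra, values outside carrier G are left unconstrained;
   equality of functions on G means equality on carrier G. *)
definition character :: "('a, 'b) monoid_scheme \<Rightarrow> ('a \<Rightarrow> complex) \<Rightarrow> bool"
  where "character G \<chi> \<longleftrightarrow> \<chi> \<in> hom G complex_mult_group"

definition additive_fun :: "('a, 'b) monoid_scheme \<Rightarrow> ('a \<Rightarrow> complex) \<Rightarrow> bool"
  where "additive_fun G A \<longleftrightarrow>
    (\<forall>x \<in> carrier G. \<forall>y \<in> carrier G. A (x \<otimes>\<^bsub>G\<^esub> y) = A x + A y)"

end

theory Submission
  imports Defs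
begin

text \<open>
  The functions \<mu>, \<chi> and \<chi>A are linearly independent. If f lies outside their span, comparing
  the two ways of expanding f(xyz) yields a relation between f, \<mu>, \<chi> and \<chi>A as functions of x;
  the coefficient of \<chi> forces h = 0 and the others make h1 a character, which is form (2). If
  f = a\<mu> + b\<chi> + c\<chi>A, comparing coefficients in the equation itself gives form (3) when b is
  nonzero and form (1) when b = 0.
\<close>

lemma character_mult:
  assumes "character G \<chi>" "x \<in> carrier G" "y \<in> carrier G"
  shows "\<chi> (x \<otimes>\<^bsub>G\<^esub> y) = \<chi> x * \<chi> y"
  using assms unfolding character_def complex_mult_group_def hom_def by auto

lemma character_nonzero:
  assumes "character G \<chi>" "x \<in> carrier G"
  shows "\<chi> x \<noteq> 0"
  using assms unfolding character_def complex_mult_group_def hom_def by auto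

lemma character_one:
  assumes "group G" "character G \<chi>"
  shows "\<chi> \<one>\<^bsub>G\<^esub> = 1"
proof -
  interpret group G by fact
  have "\<chi> \<one>\<^bsub>G\<^esub> = \<chi> \<one>\<^bsub>G\<^esub> * \<chi> \<one>\<^bsub>G\<^esub>"
    using character_mult[OF assms(2), of "\<one>\<^bsub>G\<^esub>" "\<one>\<^bsub>G\<^esub>"] by simp
  then show ?thesis
    using character_nonzero[OF assms(2), of "\<one>\<^bsub>G\<^esub>"] by simp
qed

text \<open>Nonvanishing comes for free: \<open>\<chi> x\<close> times \<open>\<chi> (inv x)\<close>
  is the value at the identity, which is 1.\<close>

lemma characterI:
  assumes "group G"
    and mult: "\<And>x y. x \<in> carrier G \<Longrightarrow> y \<in> carrier G \<Longrightarrow> \<chi> (x \<otimes>\<^bsub>G\<^esub> y) = \<chi> x * \<chi> y"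
    and one: "\<chi> \<one>\<^bsub>G\<^esub> = 1"
  shows "character G \<chi>"
proof -
  interpret group G by fact
  have "\<chi> x \<noteq> 0" if "x \<in> carrier G" for x
    using mult[OF that inv_closed[OF that]] one that by auto
  then show ?thesis
    using mult unfolding character_def complex_mult_group_def hom_def by auto
qed

lemma additive_fun_mult:
  assumes "additive_fun G A" "x \<in> carrier G" "y \<in> carrier G"
  shows "A (x \<otimes>\<^bsub>G\<^esub> y) = A x + A y"
  using assms unfolding additive_fun_def by blast

lemma additive_fun_one:
  assumes "group G" "additive_fun G A"
  shows "A \<one>\<^bsub>G\<^esub> = 0"
proof -
  interpret group G by fact
  show ?thesis
    using additive_fun_mult[OF assms(2), of "\<one>\<^bsub>G\<^esub>" "\<one>\<^bsub>G\<^esub>"] by simp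
qed

text \<open>Subtracting \<open>\<chi> y\<close> times the relation at x from the relation at the
  product of x and y cancels b and leaves \<open>diff\<close>, in which \<mu> and \<chi> can be
  separated at a point where they differ.\<close>

lemma characters_additive_independent:
  assumes G: "group G" and \<mu>: "character G \<mu>" and \<chi>: "character G \<chi>"
    and ne: "\<exists>x \<in> carrier G. \<mu> x \<noteq> \<chi> x"
    and A: "additive_fun G A" and nz: "\<exists>x \<in> carrier G. A x \<noteq> 0"
    and zero: "\<And>x. x \<in> carrier G \<Longrightarrow> a * \<mu> x + b * \<chi> x + c * (\<chi> x * A x) = 0"
  shows "a = 0" "b = 0" "c = 0"
proof -
  interpret group G by fact
  have diff: "a * \<mu> x * (\<mu> y - \<chi> y) + c * \<chi> x * \<chi> y * A y = 0"
    if "x \<in> carrier G" "y \<in> carrier G" for x y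
    using zero[OF m_closed[OF that]] zero[OF that(1)] character_mult[OF \<mu> that]
      character_mult[OF \<chi> that] additive_fun_mult[OF A that] by algebra
  obtain t where t: "t \<in> carrier G" "\<mu> t \<noteq> \<chi> t"
    using ne by blast
  \<comment> \<open>Take \<open>diff\<close> at (t, t) and subtract \<open>\<chi> t\<close> times
    \<open>diff\<close> at (identity, t): the terms with c cancel.\<close>
  have "a * ((\<mu> t - \<chi> t) * (\<mu> t - \<chi> t)) = 0"
    using diff[OF t(1) t(1)] diff[OF one_closed t(1)] character_one[OF G \<mu>]
      character_one[OF G \<chi>] by algebra
  then show a: "a = 0"
    using t by simp
  show b: "b = 0"
    using zero[OF one_closed] a character_one[OF G \<chi>] additive_fun_one[OF G A] by simp
  obtain s where "s \<in> carrier G" "A s \<noteq> 0"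
    using nz by blast
  then show "c = 0"
    using zero[of s] a b character_nonzero[OF \<chi>, of s] by simp
qed

theorem theorem7p1:
  fixes G :: "('a, 'b) monoid_scheme"
    and \<mu> \<chi> A f h1 h2 h :: "'a \<Rightarrow> complex"
  assumes "group G"
    and "character G \<mu>" and "character G \<chi>" and "\<exists>x \<in> carrier G. \<mu> x \<noteq> \<chi> x"
    and "additive_fun G A" and "\<exists>x \<in> carrier G. A x \<noteq> 0"
  shows "(\<forall>x \<in> carrier G. \<forall>y \<in> carrier G.
            f (x \<otimes>\<^bsub>G\<^esub> y) = f x * h1 y + \<mu> x * h2 y + \<chi> x * A x * h y)
    \<longleftrightarrow>
      (\<exists>a :: complex. \<forall>x \<in> carrier G.
            f x = a * \<mu> x
          \<and> h2 x = a * \<mu> x - a * h1 x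
          \<and> h x = 0)
    \<or> (\<exists>(\<mu>1 :: 'a \<Rightarrow> complex) (\<phi> :: 'a \<Rightarrow> complex) (a :: complex).
          character G \<mu>1
        \<and> (\<forall>x \<in> carrier G. \<forall>y \<in> carrier G. \<phi> (x \<otimes>\<^bsub>G\<^esub> y) = \<phi> x * \<mu>1 y + \<mu> x * \<phi> y)
        \<and> (\<forall>x \<in> carrier G.
            f x = a * \<mu>1 x + \<phi> x
          \<and> h1 x = \<mu>1 x
          \<and> h2 x = \<phi> x
          \<and> h x = 0))
    \<or> (\<exists>a \<alpha> b :: complex. b \<noteq> 0
        \<and> (\<forall>x \<in> carrier G.
            f x = a * \<mu> x + b * \<chi> x + b * \<alpha> * \<chi> x * A x
          \<and> h1 x = \<chi> x + \<alpha> * \<chi> x * A x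
          \<and> h2 x = a * \<mu> x - a * \<chi> x - a * \<alpha> * \<chi> x * A x
          \<and> h x = - \<alpha>\<^sup>2 * b * \<chi> x * A x))"
  (is "?eq \<longleftrightarrow> ?form1 \<or> ?form2 \<or> ?form3")
proof -
  interpret group G by fact
  note \<mu>_mult = character_mult[OF assms(2)] and \<chi>_mult = character_mult[OF assms(3)]
    and A_mult = additive_fun_mult[OF assms(5)]
  note independent = characters_additive_independent[OF assms]
  show ?thesis
  proof
    assume ?eq
    then have eq: "f (x \<otimes>\<^bsub>G\<^esub> y) = f x * h1 y + \<mu> x * h2 y + \<chi> x * A x * h y"
      if "x \<in> carrier G" "y \<in> carrier G" for x y
      using that by blast
    show "?form1 \<or> ?form2 \<or> ?form3"
    proof (cases "\<exists>a b c. \<forall>x \<in> carrier G. f x = a * \<mu> x + b * \<chi> x + c * (\<chi> x * A x)")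
      case True
      then obtain a b c
        where f: "\<And>x. x \<in> carrier G \<Longrightarrow> f x = a * \<mu> x + b * \<chi> x + c * (\<chi> x * A x)"
        by blast
      have coeffs: "a * \<mu> y - a * h1 y - h2 y = 0" "b * \<chi> y + c * \<chi> y * A y - b * h1 y = 0"
        "c * \<chi> y - c * h1 y - h y = 0" if y: "y \<in> carrier G" for y
      proof -
        \<comment> \<open>With y fixed, substitute the form of f on both sides of the equation and
          collect terms as functions of x; independence then kills each coefficient.\<close>
        have rel: "(a * \<mu> y - a * h1 y - h2 y) * \<mu> x + (b * \<chi> y + c * \<chi> y * A y - b * h1 y) * \<chi> x
            + (c * \<chi> y - c * h1 y - h y) * (\<chi> x * A x) = 0" if x: "x \<in> carrier G" for x
          using eq[OF x y] f[OF x] f[OF m_closed[OF x y]] \<mu>_mult[OF x y] \<chi>_mult[OF x y]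
            A_mult[OF x y] by algebra
        show "a * \<mu> y - a * h1 y - h2 y = 0" "b * \<chi> y + c * \<chi> y * A y - b * h1 y = 0"
          "c * \<chi> y - c * h1 y - h y = 0"
          using independent[OF rel] by blast+
      qed
      show ?thesis
      proof (cases "b = 0")
        case True
        obtain t where t: "t \<in> carrier G" "A t \<noteq> 0"
          using assms(6) by blast
        \<comment> \<open>For b = 0 the coefficient of \<chi> reduces to
          \<open>c * \<chi> y * A y\<close>, and at t the last two factors are nonzero. No condition
          on h1 remains.\<close>
        have "c = 0"
          using coeffs(2)[OF t(1)] t True character_nonzero[OF assms(3) t(1)] by simp
        then have "f x = a * \<mu> x \<and> h2 x = a * \<mu> x - a * h1 x \<and> h x = 0" if "x \<in> carrier G" for x
          using f[OF that] coeffs[OF that] True by simp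
        then show ?thesis
          by blast
      next
        case False
        \<comment> \<open>Dividing the coefficient of \<chi> by b gives h1 = \<chi> + (c/b) \<chi>A,
          which dictates \<alpha>. Then h = c (\<chi> - h1) = -c \<alpha> \<chi>A produces the
          factor \<open>\<alpha>\<^sup>2 * b\<close>.\<close>
        define \<alpha> where "\<alpha> = c / b"
        have c: "c = b * \<alpha>"
          using False by (simp add: \<alpha>_def)
        have "f x = a * \<mu> x + b * \<chi> x + b * \<alpha> * \<chi> x * A x \<and> h1 x = \<chi> x + \<alpha> * \<chi> x * A x
            \<and> h2 x = a * \<mu> x - a * \<chi> x - a * \<alpha> * \<chi> x * A x \<and> h x = - \<alpha>\<^sup>2 * b * \<chi> x * A x"
          if x: "x \<in> carrier G" for x
        proof -
          have "b * (h1 x - (\<chi> x + \<alpha> * \<chi> x * A x)) = 0"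
            using coeffs(2)[OF x] c by algebra
          then have h1: "h1 x = \<chi> x + \<alpha> * \<chi> x * A x"
            using False by simp
          moreover have "h2 x = a * \<mu> x - a * \<chi> x - a * \<alpha> * \<chi> x * A x"
            using coeffs(1)[OF x] h1 by algebra
          moreover have "h x = - \<alpha>\<^sup>2 * b * \<chi> x * A x"
            using coeffs(3)[OF x] h1 c by algebra
          moreover have "f x = a * \<mu> x + b * \<chi> x + b * \<alpha> * \<chi> x * A x"
            using f[OF x] c by algebra
          ultimately show ?thesis
            by blast
        qed
        then show ?thesis
          using False by blast
      qed
    next
      case False
      \<comment> \<open>Adjoining f keeps the family independent: a nonzero p would allow solving
        for f, contrary to the case assumption.\<close>
      have independent_f: "p = 0" "q = 0" "r = 0" "s = 0"
        if rel: "\<And>x. x \<in> carrier G \<Longrightarrow> p * f x + q * \<mu> x + r * \<chi> x + s * (\<chi> x * A x) = 0"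
        for p q r s
      proof -
        show p: "p = 0"
        proof (rule ccontr)
          assume "p \<noteq> 0"
          have "f x = (- q / p) * \<mu> x + (- r / p) * \<chi> x + (- s / p) * (\<chi> x * A x)"
            if "x \<in> carrier G" for x
          proof -
            have "f x = inverse p * (- q * \<mu> x - r * \<chi> x - s * (\<chi> x * A x))"
              using rel[OF that] right_inverse[OF \<open>p \<noteq> 0\<close>] by algebra
            then show ?thesis
              by (simp add: divide_inverse algebra_simps)
          qed
          then show False
            using False by blast
        qed
        show "q = 0" "r = 0" "s = 0"
          using independent[of q r s] rel p by simp_all
      qed
      have coeffs: "h1 y * h1 z - h1 (y \<otimes>\<^bsub>G\<^esub> z) = 0"
        "h2 y * h1 z + \<mu> y * h2 z - h2 (y \<otimes>\<^bsub>G\<^esub> z) = 0" "\<chi> y * A y * h z = 0"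
        if y: "y \<in> carrier G" and z: "z \<in> carrier G" for y z
      proof -
        have rel: "(h1 y * h1 z - h1 (y \<otimes>\<^bsub>G\<^esub> z)) * f x
            + (h2 y * h1 z + \<mu> y * h2 z - h2 (y \<otimes>\<^bsub>G\<^esub> z)) * \<mu> x + (\<chi> y * A y * h z) * \<chi> x
            + (h y * h1 z + \<chi> y * h z - h (y \<otimes>\<^bsub>G\<^esub> z)) * (\<chi> x * A x) = 0"
          if x: "x \<in> carrier G" for x
        proof -
          \<comment> \<open>The left side expands f(x(yz)) and the right side f((xy)z). Splitting
            A(xy) into A(x) + A(y) is what creates a pure \<chi>(x) term, with coefficient
            \<chi>(y)A(y)h(z).\<close>
          have "f x * h1 (y \<otimes>\<^bsub>G\<^esub> z) + \<mu> x * h2 (y \<otimes>\<^bsub>G\<^esub> z) + \<chi> x * A x * h (y \<otimes>\<^bsub>G\<^esub> z)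
              = (f x * h1 y + \<mu> x * h2 y + \<chi> x * A x * h y) * h1 z + \<mu> x * \<mu> y * h2 z
                + \<chi> x * \<chi> y * (A x + A y) * h z"
            using eq[OF m_closed[OF x y] z] eq[OF x m_closed[OF y z]]
            unfolding m_assoc[OF x y z] eq[OF x y] \<mu>_mult[OF x y] \<chi>_mult[OF x y] A_mult[OF x y]
            by simp
          then show ?thesis
            by (simp add: algebra_simps)
        qed
        show "h1 y * h1 z - h1 (y \<otimes>\<^bsub>G\<^esub> z) = 0"
          "h2 y * h1 z + \<mu> y * h2 z - h2 (y \<otimes>\<^bsub>G\<^esub> z) = 0" "\<chi> y * A y * h z = 0"
          using independent_f[OF rel] by blast+
      qed
      obtain t where t: "t \<in> carrier G" "A t \<noteq> 0"
        using assms(6) by blast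
      have h: "h z = 0" if "z \<in> carrier G" for z
        using coeffs(3)[OF t(1) that] t character_nonzero[OF assms(3) t(1)] by simp
      \<comment> \<open>Putting y equal to the identity in the equation gives a relation whose
        f-coefficient yields the value 1 of h1 there. This excludes h1 = 0, which multiplicativity
        alone would permit. The zero terms only match the shape of
        \<open>independent_f\<close>.\<close>
      have "(h1 \<one>\<^bsub>G\<^esub> - 1) * f x + h2 \<one>\<^bsub>G\<^esub> * \<mu> x + 0 * \<chi> x + 0 * (\<chi> x * A x) = 0"
        if "x \<in> carrier G" for x
        using eq[OF that one_closed] h[OF one_closed] that by (simp add: algebra_simps)
      note unit = independent_f(1)[OF this]
      have h1: "character G h1"
        using assms(1) coeffs(1) unit by (intro characterI) auto
      have h2: "\<forall>x \<in> carrier G. \<forall>y \<in> carrier G. h2 (x \<otimes>\<^bsub>G\<^esub> y) = h2 x * h1 y + \<mu> x * h2 y"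
        using coeffs(2) by simp
      \<comment> \<open>Putting the first argument equal to the identity reveals the witnesses of
        form (2): a is the value of f at the identity, and \<phi> is h2.\<close>
      have "f x = f \<one>\<^bsub>G\<^esub> * h1 x + h2 x" if "x \<in> carrier G" for x
        using eq[OF one_closed that]
        unfolding l_one[OF that] character_one[OF assms(1,2)] additive_fun_one[OF assms(1,5)]
        by simp
      with h have "\<forall>x \<in> carrier G. f x = f \<one>\<^bsub>G\<^esub> * h1 x + h2 x \<and> h1 x = h1 x \<and> h2 x = h2 x \<and> h x = 0"
        by blast
      with h1 h2 have ?form2
        by (intro exI[of _ h1] exI[of _ h2] exI[of _ "f \<one>\<^bsub>G\<^esub>"] conjI)
      then show ?thesis
        by blast
    qed
  next
    assume "?form1 \<or> ?form2 \<or> ?form3"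
    then show ?eq
    proof (elim disjE)
      assume ?form1
      then obtain a
        where sol: "\<forall>x \<in> carrier G. f x = a * \<mu> x \<and> h2 x = a * \<mu> x - a * h1 x \<and> h x = 0"
        by blast
      show ?eq
      proof (intro ballI)
        fix x y assume x: "x \<in> carrier G" and y: "y \<in> carrier G"
        show "f (x \<otimes>\<^bsub>G\<^esub> y) = f x * h1 y + \<mu> x * h2 y + \<chi> x * A x * h y"
          using sol x y \<mu>_mult[OF x y] by (simp add: right_diff_distrib)
      qed
    next
      assume ?form2
      then obtain \<mu>1 \<phi> a where \<mu>1: "character G \<mu>1"
        and \<phi>: "\<forall>x \<in> carrier G. \<forall>y \<in> carrier G. \<phi> (x \<otimes>\<^bsub>G\<^esub> y) = \<phi> x * \<mu>1 y + \<mu> x * \<phi> y"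
        and sol: "\<forall>x \<in> carrier G. f x = a * \<mu>1 x + \<phi> x \<and> h1 x = \<mu>1 x \<and> h2 x = \<phi> x \<and> h x = 0"
        by blast
      show ?eq
      proof (intro ballI)
        fix x y assume x: "x \<in> carrier G" and y: "y \<in> carrier G"
        show "f (x \<otimes>\<^bsub>G\<^esub> y) = f x * h1 y + \<mu> x * h2 y + \<chi> x * A x * h y"
          using sol x y character_mult[OF \<mu>1 x y] \<phi> by (simp add: distrib_right)
      qed
    next
      assume ?form3
      then obtain a \<alpha> b where sol:
        "\<And>x. x \<in> carrier G \<Longrightarrow> f x = a * \<mu> x + b * \<chi> x + b * \<alpha> * \<chi> x * A x"
        "\<And>x. x \<in> carrier G \<Longrightarrow> h1 x = \<chi> x + \<alpha> * \<chi> x * A x"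
        "\<And>x. x \<in> carrier G \<Longrightarrow> h2 x = a * \<mu> x - a * \<chi> x - a * \<alpha> * \<chi> x * A x"
        "\<And>x. x \<in> carrier G \<Longrightarrow> h x = - \<alpha>\<^sup>2 * b * \<chi> x * A x"
        by blast
      show ?eq
      proof (intro ballI)
        fix x y assume x: "x \<in> carrier G" and y: "y \<in> carrier G"
        \<comment> \<open>The product of the two \<alpha>-terms of \<open>f x\<close> and
          \<open>h1 y\<close> is cancelled by the term with \<open>h y\<close>; this is why h
          carries a minus sign and \<alpha> squared. The mixed terms \<mu>(x)\<chi>(y) and
          \<mu>(x)\<chi>(y)A(y) cancel against \<open>\<mu> x * h2 y\<close>.\<close>
        show "f (x \<otimes>\<^bsub>G\<^esub> y) = f x * h1 y + \<mu> x * h2 y + \<chi> x * A x * h y"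
          unfolding sol(1)[OF x] sol(1)[OF m_closed[OF x y]] sol(2-4)[OF y]
            \<mu>_mult[OF x y] \<chi>_mult[OF x y] A_mult[OF x y]
          by (simp add: algebra_simps power2_eq_square)
      qed
    qed
  qed
qed

end
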